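(* Consider a sequence of models indexed by $N$: for each $N$, $K=K_N\ge1$ is an integer, $\bar z\in\{1,\dots,K\}^N$ is a true membership vector, and $\{A_{ij}\}_{1\le i<j\le N}$ are independent $\operatorname{Bernoulli}(P_{ij})$ variables generated by a $K$-class stochastic blockmodel with membership vector $\bar z$, that is, $P_{ij}=\bar\theta_{\bar z_i\bar z_j}$ for all $i<j$ for a symmetric matrix $\bar\theta\in[0,1]^{K\times K}$. Let $M=\sum_{i<j}P_{ij}>0$, and let $\hat z\in\{1,\dots,K\}^N$ be a maximum-likelihood class assignment, i.e. a maximizer of $z\mapsto L(A;z)$ over $\{1,\dots,K\}^N$. Suppose that $$\max_{z\in\{1,\dots,K\}^N}|L(A;z)-\bar L_P(z)|=o_P(M).$$ Then $$\bar L_P(\bar z)-\bar L_P(\hat z)=o_P(M).$$ If furthermore the following two conditions hold along the sequence of models: (i) $\min_{1\le a\le K} N_a=\Omega(N/K)$, where $N_a$ is the size of class $a$ under $\bar z$; (ii) with the minimum taken over all pairs of distinct classes $(a,b)$ and the maximum over all classes $c$, $$\min_{(a,b)}\ \max_{c}\Big\{D\Big(\bar\theta_{ac}\,\Big\|\,\frac{\bar\theta_{ac}+\bar\theta_{bc}}2\Big)+D\Big(\bar\theta_{bc}\,\Big\|\,\frac{\bar\theta_{ac}+\bar\theta_{bc}}2\Big)\Big\}=\Omega\Big(\frac{MK}{N^2}\Big);$$ then $$N_{\mathrm e}(\hat z)=o_P(N).$$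
   Context: For $z\in\{1,\dots,K\}^N$ and symmetric $\theta\in[0,1]^{K\times K}$, $$L(A;z,\theta)=\sum_{i<j}\{A_{ij}\log\theta_{z_iz_j}+(1-A_{ij})\log(1-\theta_{z_iz_j})\},\quad \bar L_P(z,\theta)=\sum_{i<j}\{P_{ij}\log\theta_{z_iz_j}+(1-P_{ij})\log(1-\theta_{z_iz_j})\},$$ with $0\log0=0$; $L(A;z)=\sup_\theta L(A;z,\theta)$, $\bar L_P(z)=\sup_\theta\bar L_P(z,\theta)$. $N_{\mathrm e}(z)$ is the number of incorrect class assignments under $z$: every node is counted whose true class under $\bar z$ is not the majority (most frequent true) class among the nodes of its class under $z$; i.e. $N_{\mathrm e}(z)=\sum_{a=1}^K\big(\#\{i:z_i=a\}-\max_b\#\{i:z_i=a,\bar z_i=b\}\big)$. The entry $\bar\theta_{ab}$ is the common value of $P_{ij}$ over pairs $i<j$ with $\{\bar z_i,\bar z_j\}=\{a,b\}$, and is regarded as defined only if there is at least one such pair; in (ii) the maximum is over those $c$ for which both $\bar\theta_{ac}$ and $\bar\theta_{bc}$ are defined. $D(p\,\|\,p')=p\log\frac p{p'}+(1-p)\log\frac{1-p}{1-p'}$ is the Bernoulli Kullback–Leibler divergence (with $0\log 0=0\log(0/0)=0$). $f=\Omega(g)$ means there is a constant $c>0$ with $f\ge c\,g$ for all sufficiently large $N$. If $K=1$, condition (ii) is vacuous. $X_N=o_P(M)$ means $X_N/M\to0$ in probability, and similarly for $o_P(N)$. *)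

theory Defs
  imports "HOL-Probability.Probability"
begin

definition node_pairs :: "nat \<Rightarrow> (nat \<times> nat) set" where
  "node_pairs N = {(i, j). 1 \<le> i \<and> i < j \<and> j \<le> N}"

definition expected_edges :: "nat \<Rightarrow> (nat \<Rightarrow> nat \<Rightarrow> real) \<Rightarrow> real" where
  "expected_edges N P = (\<Sum>(i, j)\<in>node_pairs N. P i j)"

definition assignments :: "nat \<Rightarrow> nat \<Rightarrow> (nat \<Rightarrow> nat) set" where
  "assignments N K = {1..N} \<rightarrow>\<^sub>E {1..K}"

text \<open>Matrices are functions of two indices of which only the entries in \<open>{1..K}\<close> matter.\<close>

definition sym_prob_matrices :: "nat \<Rightarrow> (nat \<Rightarrow> nat \<Rightarrow> real) set" where
  "sym_prob_matrices K =
     {\<theta>. \<forall>a\<in>{1..K}. \<forall>b\<in>{1..K}. \<theta> a b = \<theta> b a \<and> 0 \<le> \<theta> a b \<and> \<theta> a b \<le> 1}"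

text \<open>\<open>x log y\<close> for \<open>x, y \<ge> 0\<close>, with \<open>0 log 0 = 0\<close> and \<open>x log 0 = -\<infinity>\<close> for \<open>x > 0\<close>.
  The extended reals are needed because \<open>ln 0 = 0\<close> on type \<open>real\<close>.\<close>

definition xlog :: "real \<Rightarrow> real \<Rightarrow> ereal" where
  "xlog x y = (if x = 0 then 0 else if y = 0 then -\<infinity> else ereal (x * ln y))"

text \<open>The weights \<open>W\<close> are either the adjacency indicators \<open>A\<close>, which gives \<open>L(A; z, \<theta>)\<close>,
  or the probabilities \<open>P\<close>, which gives the expected version.\<close>

definition loglik ::
  "nat \<Rightarrow> (nat \<Rightarrow> nat \<Rightarrow> real) \<Rightarrow> (nat \<Rightarrow> nat) \<Rightarrow> (nat \<Rightarrow> nat \<Rightarrow> real) \<Rightarrow> ereal" where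
  "loglik N W z \<theta> =
     (\<Sum>(i, j)\<in>node_pairs N. xlog (W i j) (\<theta> (z i) (z j)) + xlog (1 - W i j) (1 - \<theta> (z i) (z j)))"

text \<open>The supremum is taken in the extended reals and is finite for weights in \<open>[0,1]\<close>
  (lemma \<open>ereal_profile_loglik\<close> below), so that the conversion loses nothing.\<close>

definition profile_loglik ::
  "nat \<Rightarrow> nat \<Rightarrow> (nat \<Rightarrow> nat \<Rightarrow> real) \<Rightarrow> (nat \<Rightarrow> nat) \<Rightarrow> real" where
  "profile_loglik N K W z = real_of_ereal (SUP \<theta>\<in>sym_prob_matrices K. loglik N W z \<theta>)"

lemma xlog_nonpos:
  assumes "0 \<le> x" "0 \<le> y" "y \<le> 1"
  shows "xlog x y \<le> 0"
  using assms by (auto simp: xlog_def mult_nonneg_nonpos)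

lemma ereal_profile_loglik:
  assumes "\<And>i j. (i, j) \<in> node_pairs N \<Longrightarrow> 0 \<le> W i j \<and> W i j \<le> 1"
    and "z \<in> assignments N K"
  shows "ereal (profile_loglik N K W z) = (SUP \<theta>\<in>sym_prob_matrices K. loglik N W z \<theta>)"
proof -
  let ?S = "SUP \<theta>\<in>sym_prob_matrices K. loglik N W z \<theta>"
  have "loglik N W z \<theta> \<le> 0" if "\<theta> \<in> sym_prob_matrices K" for \<theta>
    unfolding loglik_def
  proof (rule sum_nonpos, clarify)
    fix i j assume ij: "(i, j) \<in> node_pairs N"
    then have "z i \<in> {1..K}" "z j \<in> {1..K}"
      using assms(2) by (auto simp: node_pairs_def assignments_def PiE_def Pi_def)
    then have "0 \<le> \<theta> (z i) (z j)" "\<theta> (z i) (z j) \<le> 1"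
      using that by (auto simp: sym_prob_matrices_def)
    then show "xlog (W i j) (\<theta> (z i) (z j)) + xlog (1 - W i j) (1 - \<theta> (z i) (z j)) \<le> 0"
      using assms(1)[OF ij] by (intro add_nonpos_nonpos xlog_nonpos) auto
  qed
  then have "?S \<le> 0"
    by (rule SUP_least)
  moreover have "?S \<noteq> -\<infinity>"
  proof -
    have half: "(\<lambda>a b. 1/2) \<in> sym_prob_matrices K"
      by (simp add: sym_prob_matrices_def)
    have "loglik N W z (\<lambda>a b. 1/2) =
        ereal (\<Sum>(i, j)\<in>node_pairs N. W i j * ln (1/2) + (1 - W i j) * ln (1/2))"
      unfolding loglik_def sum_ereal[symmetric]
      by (rule sum.cong) (auto simp: xlog_def)
    then show ?thesis
      using SUP_upper[OF half, of "loglik N W z"] by auto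
  qed
  ultimately show ?thesis
    unfolding profile_loglik_def by (intro ereal_real') auto
qed

definition class_size :: "nat \<Rightarrow> (nat \<Rightarrow> nat) \<Rightarrow> nat \<Rightarrow> nat" where
  "class_size N z a = card {i\<in>{1..N}. z i = a}"

definition num_errors :: "nat \<Rightarrow> nat \<Rightarrow> (nat \<Rightarrow> nat) \<Rightarrow> (nat \<Rightarrow> nat) \<Rightarrow> real" where
  "num_errors N K zbar z =
     (\<Sum>a\<in>{1..K}. real (class_size N z a) -
        real (MAX b\<in>{1..K}. card {i\<in>{1..N}. z i = a \<and> zbar i = b}))"

text \<open>Bernoulli Kullback--Leibler divergence for parameters in \<open>[0,1]\<close>, with
  \<open>0 log 0 = 0 log (0/0) = 0\<close> and value \<open>\<infinity>\<close> in the absence of absolute continuity.\<close>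

definition xlog_ratio :: "real \<Rightarrow> real \<Rightarrow> ereal" where
  "xlog_ratio x y = (if x = 0 then 0 else if y = 0 then \<infinity> else ereal (x * ln (x / y)))"

definition bernoulli_KL :: "real \<Rightarrow> real \<Rightarrow> ereal" where
  "bernoulli_KL p q = xlog_ratio p q + xlog_ratio (1 - p) (1 - q)"

definition entry_defined :: "nat \<Rightarrow> (nat \<Rightarrow> nat) \<Rightarrow> nat \<Rightarrow> nat \<Rightarrow> bool" where
  "entry_defined N z a b \<longleftrightarrow> (\<exists>(i, j)\<in>node_pairs N. {z i, z j} = {a, b})"

text \<open>An infimum over no pair of classes (\<open>K = 1\<close>) is \<open>\<infinity>\<close>, so lower bounds on the separation
  are then vacuous; a maximum over no admissible class \<open>c\<close> is \<open>-\<infinity>\<close>, so they then fail.\<close>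

definition class_separation ::
  "nat \<Rightarrow> nat \<Rightarrow> (nat \<Rightarrow> nat) \<Rightarrow> (nat \<Rightarrow> nat \<Rightarrow> real) \<Rightarrow> ereal" where
  "class_separation N K z \<theta> =
     (INF (a, b)\<in>{(a, b). a \<in> {1..K} \<and> b \<in> {1..K} \<and> a \<noteq> b}.
        SUP c\<in>{c\<in>{1..K}. entry_defined N z a c \<and> entry_defined N z b c}.
          bernoulli_KL (\<theta> a c) ((\<theta> a c + \<theta> b c) / 2) +
          bernoulli_KL (\<theta> b c) ((\<theta> a c + \<theta> b c) / 2))"

text \<open>\<open>X n = o\<^sub>P(r n)\<close>, where \<open>X n\<close> lives on its own probability space \<open>S n\<close>.\<close>

definition small_o_prob ::
  "(nat \<Rightarrow> 'w measure) \<Rightarrow> (nat \<Rightarrow> 'w \<Rightarrow> real) \<Rightarrow> (nat \<Rightarrow> real) \<Rightarrow> bool" where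
  "small_o_prob S X r \<longleftrightarrow>
     (\<forall>\<epsilon>>0. (\<lambda>n. measure (S n) {\<omega>\<in>space (S n). \<bar>X n \<omega> / r n\<bar> > \<epsilon>}) \<longlonglongrightarrow> 0)"

end

theory Submission
  imports Defs
begin

text \<open>Both claims rest on the deficit \<open>R = L\<^sub>P(zbar) - L\<^sub>P(zhat)\<close> of the expected profile likelihood.
  Since \<open>zhat\<close> maximizes the empirical profile likelihood, \<open>R\<close> is at most twice the uniform
  deviation between the empirical and the expected profile likelihoods
  (\<open>arg_max_perturbed\<close>), and \<open>R \<ge> 0\<close> by Gibbs' inequality.

  For the second claim, fix \<open>z\<close> and a parameter matrix \<open>\<theta>'\<close> of finite expected log-likelihood, and let
  \<open>\<theta>\<close> be the true matrix. The gap between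
  \<open>L\<^sub>P(zbar)\<close> and the expected log-likelihood at \<open>(z, \<theta>')\<close> is the sum over all dyads of the
  divergences \<open>g i k\<close> of \<open>P i k\<close> from \<open>\<theta>' (z i) (z k)\<close>, that is, half the sum over all nodes \<open>i\<close>
  of \<open>F i = (\<Sum>k\<noteq>i. g i k)\<close>.
  Suppose that \<open>i\<close> and \<open>j\<close> share a class under \<open>z\<close> but have true classes \<open>a \<noteq> b\<close>. For every node \<open>k\<close>
  of a separating class \<open>c\<close>, the dyads \<open>{i, k}\<close> and \<open>{j, k}\<close> are fitted by the same value, which
  costs at least as much as fitting both by the midpoint of \<open>\<theta> a c\<close> and \<open>\<theta> b c\<close>
  (\<open>bern_div_midpoint_le\<close>). If the separation is at least \<open>\<delta>\<close> and all true classes have size at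
  least \<open>s\<close>, this gives \<open>F i + F j \<ge> \<delta> * s / 2\<close>.

  Hence, within one class of \<open>z\<close>, the nodes with \<open>F i < \<delta> * s / 4\<close> all have the same true class, so
  they number at most the majority count, and the errors are bounded by the number of the remaining
  nodes (\<open>num_errors_le_card\<close>). Markov's inequality for counting measure now bounds the number of
  errors times \<open>\<delta> * s / 8\<close> by the deficit (\<open>num_errors_le_bern_div\<close>). With \<open>s\<close> of order \<open>N / K\<close> and
  \<open>\<delta>\<close> of order \<open>M K / N\<^sup>2\<close> the proportion of errors is at most a constant times \<open>R / M\<close>.\<close>

section \<open>Bernoulli cross entropy and divergence\<close>

text \<open>The expected log-likelihood of a Bernoulli variable with mean \<open>p\<close> under the parameter \<open>t\<close>.
  As \<open>ln 0 = 0\<close> on the reals, this is the right value only if \<open>bern_ac p t\<close> holds below; otherwise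
  the right value is \<open>-\<infinity>\<close>.\<close>

definition bern_cross :: "real \<Rightarrow> real \<Rightarrow> real" where
  "bern_cross p t = p * ln t + (1 - p) * ln (1 - t)"

text \<open>Absolute continuity of the Bernoulli law with parameter \<open>p\<close> with respect to the one with
  parameter \<open>t\<close>.\<close>

definition bern_ac :: "real \<Rightarrow> real \<Rightarrow> bool" where
  "bern_ac p t \<longleftrightarrow> (p = 0 \<or> t \<noteq> 0) \<and> (p = 1 \<or> t \<noteq> 1)"

text \<open>The Kullback--Leibler divergence as a real number. It agrees with \<open>bernoulli_KL\<close> under absolute
  continuity (lemma \<open>bernoulli_KL_eq\<close>).\<close>

definition bern_div :: "real \<Rightarrow> real \<Rightarrow> real" where
  "bern_div p t = bern_cross p p - bern_cross p t"

lemma bern_ac_refl: "bern_ac p p"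
  by (auto simp: bern_ac_def)

lemma mult_ln_Gibbs:
  fixes p t :: real
  assumes "0 \<le> p" "0 \<le> t" "p = 0 \<or> t \<noteq> 0"
  shows "p * ln t - p * ln p \<le> t - p"
proof (cases "p = 0")
  case False
  then have pos: "0 < p" "0 < t"
    using assms by auto
  then have "p * ln (t / p) \<le> p * (t / p - 1)"
    by (intro mult_left_mono ln_le_minus_one) auto
  then show ?thesis
    using pos by (simp add: ln_div algebra_simps)
qed (use assms in auto)

lemma bern_div_nonneg:
  assumes "p \<in> {0..1}" "t \<in> {0..1}" "bern_ac p t"
  shows "0 \<le> bern_div p t"
  using mult_ln_Gibbs[of p t] mult_ln_Gibbs[of "1 - p" "1 - t"] assms
  by (auto simp: bern_div_def bern_cross_def bern_ac_def)

text \<open>The total divergence of \<open>p\<close> and \<open>q\<close> from a common \<open>t\<close> is least at their midpoint \<open>m\<close>: since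
  the cross entropy is affine in its first argument, the difference of the two sides is twice the
  divergence of \<open>m\<close> from \<open>t\<close>.\<close>

lemma bern_div_midpoint_le:
  assumes "p \<in> {0..1}" "q \<in> {0..1}" "t \<in> {0..1}" "bern_ac p t" "bern_ac q t"
  shows "bern_div p ((p + q) / 2) + bern_div q ((p + q) / 2) \<le> bern_div p t + bern_div q t"
proof -
  define m where "m = (p + q) / 2"
  have "bern_ac m t"
    using assms by (auto simp: bern_ac_def m_def)
  then have "0 \<le> bern_div m t"
    using assms by (intro bern_div_nonneg) (auto simp: m_def)
  moreover have cross: "bern_cross p s + bern_cross q s = 2 * bern_cross m s" for s
    by (simp add: bern_cross_def m_def field_simps)
  ultimately show ?thesis
    unfolding bern_div_def m_def[symmetric] using cross[of m] cross[of t] by linarith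
qed

lemma xlog_ratio_eq:
  assumes "0 \<le> x" "0 \<le> y" "x = 0 \<or> y \<noteq> 0"
  shows "xlog_ratio x y = ereal (x * ln x - x * ln y)"
  using assms by (auto simp: xlog_ratio_def ln_div algebra_simps)

lemma bernoulli_KL_eq:
  assumes "p \<in> {0..1}" "t \<in> {0..1}" "bern_ac p t"
  shows "bernoulli_KL p t = ereal (bern_div p t)"
  using assms xlog_ratio_eq[of p t] xlog_ratio_eq[of "1 - p" "1 - t"]
  by (auto simp: bernoulli_KL_def bern_div_def bern_cross_def bern_ac_def algebra_simps)

section \<open>The profile likelihood\<close>

lemma node_pairs_Sigma: "node_pairs N = (SIGMA i:{1..N}. {i<..N})"
  by (auto simp: node_pairs_def)

lemma finite_node_pairs [simp]: "finite (node_pairs N)"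
  by (simp add: node_pairs_Sigma)

lemma finite_assignments [simp]: "finite (assignments N K)"
  by (auto simp: assignments_def intro: finite_PiE)

lemma assignments_mem:
  assumes "z \<in> assignments N K" "i \<in> {1..N}"
  shows "z i \<in> {1..K}"
  using assms by (auto simp: assignments_def)

lemma xlog_add_eq:
  "xlog p t + xlog (1 - p) (1 - t) = (if bern_ac p t then ereal (bern_cross p t) else -\<infinity>)"
  by (auto simp: xlog_def bern_ac_def bern_cross_def)

lemma loglik_eq:
  assumes "\<And>i j. (i, j) \<in> node_pairs N \<Longrightarrow> bern_ac (W i j) (\<theta> (z i) (z j))"
  shows "loglik N W z \<theta> = ereal (\<Sum>(i, j)\<in>node_pairs N. bern_cross (W i j) (\<theta> (z i) (z j)))"
  unfolding loglik_def sum_ereal[symmetric]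
  using assms by (intro sum.cong) (auto simp: xlog_add_eq)

lemma loglik_finiteD:
  assumes "loglik N W z \<theta> \<noteq> -\<infinity>" "(i, j) \<in> node_pairs N"
  shows "bern_ac (W i j) (\<theta> (z i) (z j))"
proof (rule ccontr)
  assume no: "\<not> ?thesis"
  let ?f = "\<lambda>(i, j). xlog (W i j) (\<theta> (z i) (z j)) + xlog (1 - W i j) (1 - \<theta> (z i) (z j))"
  have "loglik N W z \<theta> = ?f (i, j) + (\<Sum>d\<in>node_pairs N - {(i, j)}. ?f d)"
    unfolding loglik_def using assms(2) by (subst sum.remove) auto
  moreover have "(\<Sum>d\<in>node_pairs N - {(i, j)}. ?f d) \<noteq> \<infinity>"
    by (subst sum_Pinfty) (auto simp: xlog_add_eq split: if_splits)
  ultimately have "loglik N W z \<theta> = -\<infinity>"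
    using no by (auto simp: xlog_add_eq)
  with assms(1) show False ..
qed

lemma profile_loglik_cong:
  assumes "\<And>i j. (i, j) \<in> node_pairs N \<Longrightarrow> W i j = W' i j"
  shows "profile_loglik N K W = profile_loglik N K W'"
proof -
  have "loglik N W z \<theta> = loglik N W' z \<theta>" for z \<theta>
    unfolding loglik_def using assms by (intro sum.cong) auto
  then show ?thesis
    by (simp add: profile_loglik_def fun_eq_iff)
qed

lemma sum_offdiag_eq:
  fixes g :: "nat \<Rightarrow> nat \<Rightarrow> real"
  assumes "\<And>i j. (i, j) \<in> node_pairs N \<Longrightarrow> g j i = g i j"
  shows "(\<Sum>i\<in>{1..N}. \<Sum>j\<in>{1..N} - {i}. g i j) = 2 * (\<Sum>(i, j)\<in>node_pairs N. g i j)"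
proof -
  let ?swap = "\<lambda>(i, j). (j, i)"
  have eq: "(SIGMA i:{1..N}. {1..N} - {i}) = node_pairs N \<union> ?swap ` node_pairs N"
    by (force simp: node_pairs_def image_iff)
  have "(\<Sum>i\<in>{1..N}. \<Sum>j\<in>{1..N} - {i}. g i j) = (\<Sum>(i, j)\<in>(SIGMA i:{1..N}. {1..N} - {i}). g i j)"
    by (subst sum.Sigma) auto
  also have "\<dots> = (\<Sum>(i, j)\<in>node_pairs N. g i j) + (\<Sum>(i, j)\<in>?swap ` node_pairs N. g i j)"
    unfolding eq
    by (rule sum.union_disjoint[OF finite_node_pairs finite_imageI[OF finite_node_pairs]])
      (auto simp: node_pairs_def)
  also have "(\<Sum>(i, j)\<in>?swap ` node_pairs N. g i j) = (\<Sum>(i, j)\<in>node_pairs N. g j i)"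
    by (subst sum.reindex) (auto simp: inj_on_def case_prod_beta)
  also have "\<dots> = (\<Sum>(i, j)\<in>node_pairs N. g i j)"
    using assms by (intro sum.cong) auto
  finally show ?thesis
    by simp
qed

section \<open>Errors and the likelihood deficit\<close>

text \<open>If the nodes outside \<open>H\<close> are consistent, in the sense that any two of them in the same class
  under \<open>z\<close> also have the same true class, then each class of \<open>z\<close> has at most as many nodes outside
  \<open>H\<close> as its majority count.\<close>

lemma num_errors_le_card:
  assumes z: "z \<in> assignments N K" and zbar: "zbar \<in> assignments N K"
    and good: "\<And>i j. \<lbrakk>i \<in> {1..N}; j \<in> {1..N}; i \<notin> H; j \<notin> H; z i = z j\<rbrakk> \<Longrightarrow> zbar i = zbar j"
  shows "num_errors N K zbar z \<le> real (card {i\<in>{1..N}. i \<in> H})"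
proof -
  have "real (class_size N z a) - real (MAX b\<in>{1..K}. card {i\<in>{1..N}. z i = a \<and> zbar i = b})
      \<le> real (card {i\<in>{i\<in>{1..N}. i \<in> H}. z i = a})" if a: "a \<in> {1..K}" for a
  proof -
    define G where "G = {i\<in>{1..N}. z i = a \<and> i \<notin> H}"
    define m where "m = (MAX b\<in>{1..K}. card {i\<in>{1..N}. z i = a \<and> zbar i = b})"
    have "{i\<in>{1..N}. z i = a} = {i\<in>{i\<in>{1..N}. i \<in> H}. z i = a} \<union> G"
      by (auto simp: G_def)
    then have "class_size N z a \<le> card {i\<in>{i\<in>{1..N}. i \<in> H}. z i = a} + card G"
      unfolding class_size_def by (simp only: card_Un_le)
    moreover have "card G \<le> m"
    proof (cases "G = {}")
      case False
      then obtain i where i: "i \<in> G"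
        by auto
      have "G \<subseteq> {j\<in>{1..N}. z j = a \<and> zbar j = zbar i}"
        using i by (auto simp: G_def intro!: good)
      then have "card G \<le> card {j\<in>{1..N}. z j = a \<and> zbar j = zbar i}"
        by (intro card_mono) auto
      also have "\<dots> \<le> m"
        unfolding m_def using assignments_mem[OF zbar, of i] i by (intro Max_ge) (auto simp: G_def)
      finally show ?thesis .
    qed auto
    ultimately show ?thesis
      unfolding m_def[symmetric] by linarith
  qed
  then have "num_errors N K zbar z
      \<le> (\<Sum>a\<in>{1..K}. real (card {i\<in>{i\<in>{1..N}. i \<in> H}. z i = a}))"
    unfolding num_errors_def by (rule sum_mono)
  also have "\<dots> = real (card {i\<in>{1..N}. i \<in> H})"
    using sum.group[of "{i\<in>{1..N}. i \<in> H}" "{1..K}" z "\<lambda>_. 1 :: real"] assignments_mem[OF z]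
    by (simp add: image_subset_iff)
  finally show ?thesis .
qed

lemma num_errors_nonneg:
  assumes "K \<ge> 1"
  shows "0 \<le> num_errors N K zbar z"
  unfolding num_errors_def
proof (rule sum_nonneg)
  fix a
  have "(MAX b\<in>{1..K}. card {i\<in>{1..N}. z i = a \<and> zbar i = b}) \<le> class_size N z a"
    using assms by (subst Max_le_iff) (auto simp: class_size_def intro!: card_mono)
  then show "0 \<le> real (class_size N z a)
      - real (MAX b\<in>{1..K}. card {i\<in>{1..N}. z i = a \<and> zbar i = b})"
    by simp
qed

text \<open>A real lower bound on the separation is attained, for each pair of classes, at some class \<open>c\<close>
  for which both entries are defined.\<close>

lemma class_separation_witness:
  assumes sep: "ereal \<delta> \<le> class_separation N K zbar \<theta>"
    and \<theta>: "\<theta> \<in> sym_prob_matrices K"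
    and ab: "a \<in> {1..K}" "b \<in> {1..K}" "a \<noteq> b"
  obtains c where "c \<in> {1..K}" "entry_defined N zbar a c" "entry_defined N zbar b c"
    "\<delta> \<le> bern_div (\<theta> a c) ((\<theta> a c + \<theta> b c) / 2) + bern_div (\<theta> b c) ((\<theta> a c + \<theta> b c) / 2)"
proof -
  let ?C = "{c\<in>{1..K}. entry_defined N zbar a c \<and> entry_defined N zbar b c}"
  let ?D = "\<lambda>c. bernoulli_KL (\<theta> a c) ((\<theta> a c + \<theta> b c) / 2) +
          bernoulli_KL (\<theta> b c) ((\<theta> a c + \<theta> b c) / 2)"
  have "class_separation N K zbar \<theta> \<le> (SUP c\<in>?C. ?D c)"
    unfolding class_separation_def using ab by (intro INF_lower2[of "(a, b)"]) auto
  with sep have le: "ereal \<delta> \<le> (SUP c\<in>?C. ?D c)"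
    by (rule order_trans)
  \<comment> \<open>The supremum over no class is \<open>-\<infinity>\<close>, which is below the real number \<open>\<delta>\<close>.\<close>
  have "?C \<noteq> {}"
  proof
    assume "?C = {}"
    then have "(SUP c\<in>?C. ?D c) = -\<infinity>"
      by (simp only: SUP_empty bot_ereal_def)
    with le show False
      by simp
  qed
  then have "(SUP c\<in>?C. ?D c) \<in> ?D ` ?C"
    by (subst Max_Sup[symmetric]) (auto intro!: Max_in)
  then obtain c where c: "c \<in> ?C" "(SUP c\<in>?C. ?D c) = ?D c"
    by auto
  have range: "\<theta> a c \<in> {0..1}" "\<theta> b c \<in> {0..1}"
    using \<theta> ab c by (auto simp: sym_prob_matrices_def)
  then have "bern_ac (\<theta> a c) ((\<theta> a c + \<theta> b c) / 2)" "bern_ac (\<theta> b c) ((\<theta> a c + \<theta> b c) / 2)"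
    by (auto simp: bern_ac_def)
  with le c range show ?thesis
    by (intro that[of c]) (auto simp: bernoulli_KL_eq)
qed

text \<open>A separating class keeps at least half of its nodes when \<open>i\<close> and \<open>j\<close> are removed: as their true
  classes differ, at most one of them belongs to \<open>c\<close>, and if one does, then the entry \<open>(c, c)\<close> is
  defined, so that \<open>c\<close> has at least two nodes.\<close>

lemma card_class_remove_two:
  assumes "i \<in> {1..N}" "j \<in> {1..N}" "zbar i \<noteq> zbar j"
    and "entry_defined N zbar (zbar i) c" "entry_defined N zbar (zbar j) c"
  shows "class_size N zbar c \<le> 2 * card ({k\<in>{1..N}. zbar k = c} - {i, j})"
proof -
  let ?C = "{k\<in>{1..N}. zbar k = c}"
  have two: "2 \<le> card ?C" if ent: "entry_defined N zbar c c"
  proof -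
    obtain k l where "(k, l) \<in> node_pairs N" "zbar k = c" "zbar l = c"
      using ent by (auto simp: entry_defined_def)
    then have "{k, l} \<subseteq> ?C" "card {k, l} = 2"
      by (auto simp: node_pairs_def)
    moreover have "finite ?C"
      by simp
    ultimately show ?thesis
      by (metis card_mono)
  qed
  consider "c = zbar i" | "c = zbar j" | "c \<noteq> zbar i" "c \<noteq> zbar j"
    by blast
  then show ?thesis
  proof cases
    case 1
    then have "?C - {i, j} = ?C - {i}"
      using assms by auto
    with two 1 assms show ?thesis
      by (simp add: class_size_def)
  next
    case 2
    then have "?C - {i, j} = ?C - {j}"
      using assms by auto
    with two 2 assms show ?thesis
      by (simp add: class_size_def)
  next
    case 3
    then have "?C - {i, j} = ?C"
      by auto
    then show ?thesis
      by (simp add: class_size_def)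
  qed
qed

lemma sum_offdiag_pair_ge:
  fixes g :: "nat \<Rightarrow> nat \<Rightarrow> real"
  assumes ij: "i \<in> {1..N}" "j \<in> {1..N}"
    and nonneg: "\<And>i k. \<lbrakk>i \<in> {1..N}; k \<in> {1..N} - {i}\<rbrakk> \<Longrightarrow> 0 \<le> g i k"
    and C: "C \<subseteq> {1..N} - {i, j}"
    and ge: "\<And>k. k \<in> C \<Longrightarrow> \<delta> \<le> g i k + g j k"
  shows "\<delta> * card C \<le> (\<Sum>k\<in>{1..N} - {i}. g i k) + (\<Sum>k\<in>{1..N} - {j}. g j k)"
proof -
  have "\<delta> * card C \<le> (\<Sum>k\<in>C. g i k + g j k)"
    using sum_mono[of C "\<lambda>_. \<delta>"] ge by (simp add: mult.commute)
  also have "\<dots> = (\<Sum>k\<in>C. g i k) + (\<Sum>k\<in>C. g j k)"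
    by (rule sum.distrib)
  also have "\<dots> \<le> (\<Sum>k\<in>{1..N} - {i}. g i k) + (\<Sum>k\<in>{1..N} - {j}. g j k)"
    using ij C nonneg by (intro add_mono sum_mono2) auto
  finally show ?thesis .
qed

text \<open>The combinatorial core: misclassified nodes force a divergence of order \<open>\<delta> * s\<close> each, whatever
  the fitted matrix \<open>\<theta>'\<close> of finite expected log-likelihood.\<close>

lemma num_errors_le_bern_div:
  fixes \<theta> \<theta>' :: "nat \<Rightarrow> nat \<Rightarrow> real"
  assumes z: "z \<in> assignments N K" and zbar: "zbar \<in> assignments N K"
    and \<theta>: "\<theta> \<in> sym_prob_matrices K" and \<theta>': "\<theta>' \<in> sym_prob_matrices K"
    and ac: "\<And>i j. (i, j) \<in> node_pairs N \<Longrightarrow> bern_ac (\<theta> (zbar i) (zbar j)) (\<theta>' (z i) (z j))"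
    and \<delta>: "0 \<le> \<delta>" "ereal \<delta> \<le> class_separation N K zbar \<theta>"
    and s: "0 \<le> s" "\<And>a. a \<in> {1..K} \<Longrightarrow> s \<le> real (class_size N zbar a)"
  shows "num_errors N K zbar z * (\<delta> * s / 8)
    \<le> (\<Sum>(i, j)\<in>node_pairs N. bern_div (\<theta> (zbar i) (zbar j)) (\<theta>' (z i) (z j)))"
proof -
  define g where "g = (\<lambda>i j. bern_div (\<theta> (zbar i) (zbar j)) (\<theta>' (z i) (z j)))"
  define F where "F = (\<lambda>i. \<Sum>j\<in>{1..N} - {i}. g i j)"
  define B where "B = \<delta> * s / 2"
  have B: "0 \<le> B"
    using \<delta>(1) s(1) by (simp add: B_def)
  have sym: "\<theta> (zbar i) (zbar j) = \<theta> (zbar j) (zbar i)" "\<theta>' (z i) (z j) = \<theta>' (z j) (z i)"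
    and range: "\<theta> (zbar i) (zbar j) \<in> {0..1}" "\<theta>' (z i) (z j) \<in> {0..1}"
    if "i \<in> {1..N}" "j \<in> {1..N}" for i j
    using \<theta> \<theta>' assignments_mem[OF z that(1)] assignments_mem[OF z that(2)]
      assignments_mem[OF zbar that(1)] assignments_mem[OF zbar that(2)]
    by (auto simp: sym_prob_matrices_def)
  have ac': "bern_ac (\<theta> (zbar i) (zbar j)) (\<theta>' (z i) (z j))"
    if ij: "i \<in> {1..N}" "j \<in> {1..N} - {i}" for i j
  proof (cases "i < j")
    case True
    with ij ac show ?thesis
      by (auto simp: node_pairs_def)
  next
    case False
    with ij have "(j, i) \<in> node_pairs N"
      by (auto simp: node_pairs_def)
    from ac[OF this] sym[of i j] ij show ?thesis
      by simp
  qed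
  have g_nonneg: "0 \<le> g i j" if "i \<in> {1..N}" "j \<in> {1..N} - {i}" for i j
    unfolding g_def using that by (intro bern_div_nonneg ac' range) auto
  have F_nonneg: "0 \<le> F i" if "i \<in> {1..N}" for i
    unfolding F_def using that g_nonneg by (intro sum_nonneg) auto
  have pair: "B \<le> F i + F j"
    if ij: "i \<in> {1..N}" "j \<in> {1..N}" and same: "z i = z j" and diff: "zbar i \<noteq> zbar j" for i j
  proof -
    obtain c where c: "c \<in> {1..K}" "entry_defined N zbar (zbar i) c" "entry_defined N zbar (zbar j) c"
      and D: "\<delta> \<le> bern_div (\<theta> (zbar i) c) ((\<theta> (zbar i) c + \<theta> (zbar j) c) / 2)
        + bern_div (\<theta> (zbar j) c) ((\<theta> (zbar i) c + \<theta> (zbar j) c) / 2)"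
      using class_separation_witness[OF \<delta>(2) \<theta> assignments_mem[OF zbar ij(1)]
        assignments_mem[OF zbar ij(2)] diff] by blast
    let ?C = "{k\<in>{1..N}. zbar k = c} - {i, j}"
    have "\<delta> \<le> g i k + g j k" if k: "k \<in> ?C" for k
    proof -
      have "bern_ac (\<theta> (zbar i) c) (\<theta>' (z i) (z k))" "bern_ac (\<theta> (zbar j) c) (\<theta>' (z i) (z k))"
        using ac'[of i k] ac'[of j k] ij k same by auto
      moreover have "\<theta> (zbar i) c \<in> {0..1}" "\<theta> (zbar j) c \<in> {0..1}" "\<theta>' (z i) (z k) \<in> {0..1}"
        using range[of i k] range[of j k] ij k by auto
      ultimately have "bern_div (\<theta> (zbar i) c) ((\<theta> (zbar i) c + \<theta> (zbar j) c) / 2)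
          + bern_div (\<theta> (zbar j) c) ((\<theta> (zbar i) c + \<theta> (zbar j) c) / 2) \<le> g i k + g j k"
        using bern_div_midpoint_le[of "\<theta> (zbar i) c" "\<theta> (zbar j) c" "\<theta>' (z i) (z k)"]
          k same by (simp add: g_def)
      with D show ?thesis
        by linarith
    qed
    then have "\<delta> * card ?C \<le> F i + F j"
      unfolding F_def using ij g_nonneg by (intro sum_offdiag_pair_ge) auto
    moreover have "B \<le> \<delta> * card ?C"
    proof -
      have "s \<le> 2 * real (card ?C)"
        using card_class_remove_two[OF ij diff c(2,3)] s(2)[OF c(1)] by linarith
      then show ?thesis
        using mult_left_mono[OF _ \<delta>(1), of s] by (force simp: B_def)
    qed
    ultimately show ?thesis
      by linarith
  qed
  \<comment> \<open>Two nodes outside \<open>?H\<close> have \<open>F i + F j < B\<close>, so \<open>pair\<close> makes them consistent.\<close>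
  let ?H = "{i. B / 2 \<le> F i}"
  have errors: "num_errors N K zbar z \<le> real (card {i\<in>{1..N}. i \<in> ?H})"
  proof (rule num_errors_le_card[OF z zbar], rule ccontr)
    fix i j assume "i \<in> {1..N}" "j \<in> {1..N}" "i \<notin> ?H" "j \<notin> ?H" "z i = z j" "zbar i \<noteq> zbar j"
    with pair[of i j] show False
      by auto
  qed
  have "(\<Sum>i\<in>{1..N}. F i) = 2 * (\<Sum>(i, j)\<in>node_pairs N. g i j)"
    unfolding F_def
  proof (rule sum_offdiag_eq)
    fix i j assume "(i, j) \<in> node_pairs N"
    then show "g j i = g i j"
      using sym[of i j] by (auto simp: g_def node_pairs_def)
  qed
  moreover have "num_errors N K zbar z * (B / 2) \<le> (\<Sum>i\<in>{1..N}. F i)"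
  proof -
    have "num_errors N K zbar z * (B / 2) \<le> real (card {i\<in>{1..N}. i \<in> ?H}) * (B / 2)"
      using errors B by (intro mult_right_mono) auto
    also have "\<dots> \<le> (\<Sum>i\<in>{i\<in>{1..N}. i \<in> ?H}. F i)"
      using sum_mono[of "{i\<in>{1..N}. i \<in> ?H}" "\<lambda>_. B / 2" F] by simp
    also have "\<dots> \<le> (\<Sum>i\<in>{1..N}. F i)"
      using F_nonneg by (intro sum_mono2) auto
    finally show ?thesis .
  qed
  ultimately have "num_errors N K zbar z * (B / 2) \<le> 2 * (\<Sum>(i, j)\<in>node_pairs N. g i j)"
    by simp
  then show ?thesis
    by (simp add: B_def g_def)
qed

text \<open>The expected log-likelihood at \<open>(z, \<theta>')\<close> falls short of its maximum \<open>L\<^sub>P(zbar)\<close>, the negative entropy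
  of all dyads, by the total divergence. Matrices \<open>\<theta>'\<close> that violate absolute continuity on some dyad
  have log-likelihood \<open>-\<infinity>\<close> and do not matter for the supremum.\<close>

lemma profile_loglik_deficit_ge:
  assumes z: "z \<in> assignments N K" and zbar: "zbar \<in> assignments N K"
    and \<theta>: "\<theta> \<in> sym_prob_matrices K"
    and P: "\<And>i j. (i, j) \<in> node_pairs N \<Longrightarrow> P i j = \<theta> (zbar i) (zbar j)"
    and lower: "\<And>\<theta>'. \<lbrakk>\<theta>' \<in> sym_prob_matrices K;
        \<And>i j. (i, j) \<in> node_pairs N \<Longrightarrow> bern_ac (\<theta> (zbar i) (zbar j)) (\<theta>' (z i) (z j))\<rbrakk>
      \<Longrightarrow> \<Delta> \<le> (\<Sum>(i, j)\<in>node_pairs N. bern_div (\<theta> (zbar i) (zbar j)) (\<theta>' (z i) (z j)))"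
  shows "\<Delta> \<le> profile_loglik N K P zbar - profile_loglik N K P z"
proof -
  define h where "h = (\<Sum>(i, j)\<in>node_pairs N. bern_cross (P i j) (P i j))"
  have range: "0 \<le> P i j \<and> P i j \<le> 1" if "(i, j) \<in> node_pairs N" for i j
    using that P[OF that] \<theta> assignments_mem[OF zbar, of i] assignments_mem[OF zbar, of j]
    by (auto simp: sym_prob_matrices_def node_pairs_def)
  have "loglik N P z \<theta>' \<le> ereal (h - \<Delta>)" if \<theta>': "\<theta>' \<in> sym_prob_matrices K" for \<theta>'
  proof (cases "loglik N P z \<theta>' = -\<infinity>")
    case False
    then have ac: "bern_ac (P i j) (\<theta>' (z i) (z j))" if "(i, j) \<in> node_pairs N" for i j
      using loglik_finiteD that by blast
    have "\<Delta> \<le> (\<Sum>(i, j)\<in>node_pairs N. bern_div (\<theta> (zbar i) (zbar j)) (\<theta>' (z i) (z j)))"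
      using \<theta>' ac P by (intro lower) auto
    also have "\<dots> = (\<Sum>(i, j)\<in>node_pairs N.
        bern_cross (P i j) (P i j) - bern_cross (P i j) (\<theta>' (z i) (z j)))"
      using P by (intro sum.cong) (auto simp: bern_div_def)
    also have "\<dots> = h - (\<Sum>(i, j)\<in>node_pairs N. bern_cross (P i j) (\<theta>' (z i) (z j)))"
      by (simp add: h_def case_prod_beta sum_subtractf)
    finally show ?thesis
      using loglik_eq[of N P \<theta>' z] ac by simp
  qed simp
  then have "ereal (profile_loglik N K P z) \<le> ereal (h - \<Delta>)"
    using ereal_profile_loglik[of N P z K] range z by (simp add: SUP_least)
  moreover have "ereal h \<le> ereal (profile_loglik N K P zbar)"
  proof -
    have "loglik N P zbar \<theta> = (\<Sum>(i, j)\<in>node_pairs N. bern_cross (P i j) (\<theta> (zbar i) (zbar j)))"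
      using P by (intro loglik_eq) (simp add: bern_ac_refl)
    also have "\<dots> = ereal h"
      unfolding h_def using P by (intro arg_cong[where f = ereal] sum.cong) auto
    finally show ?thesis
      using ereal_profile_loglik[of N P zbar K] range zbar SUP_upper[OF \<theta>, of "loglik N P zbar"]
      by simp
  qed
  ultimately show ?thesis
    by simp
qed

section \<open>Convergence in probability\<close>

text \<open>Only the dominating variables \<open>Y\<close> need to be measurable: \<open>measure\<close> vanishes on nonmeasurable
  sets, so its monotonicity needs only the larger set to be measurable.\<close>

lemma small_o_prob_dominated:
  assumes Y: "small_o_prob S Y r"
    and prob: "\<forall>\<^sub>F n in sequentially. prob_space (S n)"
    and meas: "\<forall>\<^sub>F n in sequentially. Y n \<in> borel_measurable (S n)"
    and dom: "\<forall>\<^sub>F n in sequentially. \<forall>\<omega>\<in>space (S n). \<bar>X n \<omega> / q n\<bar> \<le> C * \<bar>Y n \<omega> / r n\<bar>"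
    and C: "0 < C"
  shows "small_o_prob S X q"
  unfolding small_o_prob_def
proof (intro allI impI)
  fix \<epsilon> :: real assume \<epsilon>: "\<epsilon> > 0"
  let ?Y = "\<lambda>n. {\<omega>\<in>space (S n). \<bar>Y n \<omega> / r n\<bar> > \<epsilon> / C}"
  let ?X = "\<lambda>n. {\<omega>\<in>space (S n). \<bar>X n \<omega> / q n\<bar> > \<epsilon>}"
  have "(\<lambda>n. measure (S n) (?Y n)) \<longlonglongrightarrow> 0"
    using Y \<epsilon> C by (simp add: small_o_prob_def)
  moreover have "\<forall>\<^sub>F n in sequentially. measure (S n) (?X n) \<le> measure (S n) (?Y n)"
    using prob meas dom
  proof eventually_elim
    case (elim n)
    interpret prob_space "S n"
      by fact
    have "?Y n \<in> sets (S n)"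
      using elim(2) by measurable
    moreover have "?X n \<subseteq> ?Y n"
    proof clarify
      fix \<omega> assume "\<omega> \<in> space (S n)" "\<epsilon> < \<bar>X n \<omega> / q n\<bar>"
      then have "\<epsilon> < C * \<bar>Y n \<omega> / r n\<bar>"
        using elim(3) by fastforce
      then show "\<epsilon> / C < \<bar>Y n \<omega> / r n\<bar>"
        using C by (simp add: pos_divide_less_eq mult.commute)
    qed
    ultimately show ?case
      by (rule finite_measure_mono[rotated])
  qed
  ultimately have "\<forall>\<^sub>F n in sequentially. measure (S n) (?X n) \<le> measure (S n) (?Y n)"
    "(\<lambda>n. measure (S n) (?Y n)) \<longlonglongrightarrow> 0"
    by blast+
  then show "(\<lambda>n. measure (S n) (?X n)) \<longlonglongrightarrow> 0"
    by (rule tendsto_sandwich[OF _ _ tendsto_const, rotated]) simp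
qed

text \<open>A random graph on finitely many nodes takes finitely many values, so every function of it is
  measurable.\<close>

lemma borel_measurable_of_edges:
  fixes A :: "nat \<Rightarrow> nat \<Rightarrow> 'w \<Rightarrow> bool" and G :: "(nat \<times> nat) set \<Rightarrow> real"
  assumes A: "\<And>i j. (i, j) \<in> node_pairs N \<Longrightarrow> A i j \<in> measurable M (count_space UNIV)"
  shows "(\<lambda>\<omega>. G {(i, j)\<in>node_pairs N. A i j \<omega>}) \<in> borel_measurable M"
proof -
  have "(\<lambda>\<omega>. {(i, j)\<in>node_pairs N. A i j \<omega>}) \<in> measurable M (count_space (Pow (node_pairs N)))"
  proof (subst measurable_count_space_eq2[OF finite_Pow_iff[THEN iffD2, OF finite_node_pairs]],
      intro conjI ballI)
    fix E assume "E \<in> Pow (node_pairs N)"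
    then have "(\<lambda>\<omega>. {(i, j)\<in>node_pairs N. A i j \<omega>}) -` {E} \<inter> space M
        = {\<omega>\<in>space M. \<forall>p\<in>node_pairs N. A (fst p) (snd p) \<omega> = (p \<in> E)}"
      by (force simp: set_eq_iff)
    also have "\<dots> \<in> sets M"
    proof (rule sets.sets_Collect_finite_All)
      fix p assume "p \<in> node_pairs N"
      then have [measurable]: "A (fst p) (snd p) \<in> measurable M (count_space UNIV)"
        using A by (metis prod.collapse)
      show "{\<omega>\<in>space M. A (fst p) (snd p) \<omega> = (p \<in> E)} \<in> sets M"
        by measurable
    qed auto
    finally show "(\<lambda>\<omega>. {(i, j)\<in>node_pairs N. A i j \<omega>}) -` {E} \<inter> space M \<in> sets M" .
  qed auto
  from measurable_compose[OF this, of G borel] show ?thesis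
    by simp
qed

section \<open>Maximum-likelihood class assignments\<close>

lemma arg_max_perturbed:
  fixes f g :: "'a \<Rightarrow> real"
  assumes "finite Z" "is_arg_max f (\<lambda>z. z \<in> Z) zmax" "w \<in> Z"
  shows "g w - g zmax \<le> 2 * (MAX z\<in>Z. \<bar>f z - g z\<bar>)"
proof -
  have le: "\<bar>f z - g z\<bar> \<le> (MAX z\<in>Z. \<bar>f z - g z\<bar>)" if "z \<in> Z" for z
    using assms(1) that by (intro Max_ge) auto
  have "zmax \<in> Z" "f w \<le> f zmax"
    using assms(2,3) by (auto simp: is_arg_max_def not_less)
  then show ?thesis
    using le[of w] le[of zmax] assms(3) by linarith
qed

theorem theorem3:
  fixes S :: "nat \<Rightarrow> 'w measure"
    and K :: "nat \<Rightarrow> nat"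
    and zbar :: "nat \<Rightarrow> nat \<Rightarrow> nat"
    and \<theta>bar P :: "nat \<Rightarrow> nat \<Rightarrow> nat \<Rightarrow> real"
    and A :: "nat \<Rightarrow> nat \<Rightarrow> nat \<Rightarrow> 'w \<Rightarrow> bool"
    and zhat :: "nat \<Rightarrow> 'w \<Rightarrow> nat \<Rightarrow> nat"
  assumes prob: "\<And>N. N \<ge> 2 \<Longrightarrow> prob_space (S N)"
    and K: "\<And>N. N \<ge> 2 \<Longrightarrow> K N \<ge> 1"
    and zbar: "\<And>N. N \<ge> 2 \<Longrightarrow> zbar N \<in> assignments N (K N)"
    and \<theta>bar: "\<And>N. N \<ge> 2 \<Longrightarrow> \<theta>bar N \<in> sym_prob_matrices (K N)"
    and P: "\<And>N i j. N \<ge> 2 \<Longrightarrow> (i, j) \<in> node_pairs N \<Longrightarrow> P N i j = \<theta>bar N (zbar N i) (zbar N j)"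
    and A_indep: "\<And>N. N \<ge> 2 \<Longrightarrow>
      prob_space.indep_vars (S N) (\<lambda>_. count_space UNIV) (\<lambda>(i, j). A N i j) (node_pairs N)"
    and A_distr: "\<And>N i j. N \<ge> 2 \<Longrightarrow> (i, j) \<in> node_pairs N \<Longrightarrow>
      distr (S N) (count_space UNIV) (A N i j) = measure_pmf (bernoulli_pmf (P N i j))"
    and M_pos: "\<And>N. N \<ge> 2 \<Longrightarrow> expected_edges N (P N) > 0"
    and zhat_measurable: "\<And>N. N \<ge> 2 \<Longrightarrow>
      zhat N \<in> measurable (S N) (count_space (assignments N (K N)))"
    and zhat_ML: "\<And>N \<omega>. N \<ge> 2 \<Longrightarrow> \<omega> \<in> space (S N) \<Longrightarrow>
      is_arg_max (profile_loglik N (K N) (\<lambda>i j. of_bool (A N i j \<omega>)))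
        (\<lambda>z. z \<in> assignments N (K N)) (zhat N \<omega>)"
    and uniform: "small_o_prob S
      (\<lambda>N \<omega>. MAX z\<in>assignments N (K N).
         \<bar>profile_loglik N (K N) (\<lambda>i j. of_bool (A N i j \<omega>)) z - profile_loglik N (K N) (P N) z\<bar>)
      (\<lambda>N. expected_edges N (P N))"
  shows "small_o_prob S
      (\<lambda>N \<omega>. profile_loglik N (K N) (P N) (zbar N)
         - profile_loglik N (K N) (P N) (zhat N \<omega>))
      (\<lambda>N. expected_edges N (P N)) \<and>
    ((\<exists>c>0. \<forall>\<^sub>F N in sequentially.
        real (MIN a\<in>{1..K N}. class_size N (zbar N) a) \<ge> c * (real N / real (K N))) \<and>
     (\<exists>c>0. \<forall>\<^sub>F N in sequentially.
        class_separation N (K N) (zbar N) (\<theta>bar N)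
          \<ge> ereal (c * (expected_edges N (P N) * real (K N) / real N ^ 2))) \<longrightarrow>
     small_o_prob S (\<lambda>N \<omega>. num_errors N (K N) (zbar N) (zhat N \<omega>)) real)"
proof -
  define M where "M = (\<lambda>N. expected_edges N (P N))"
  define Y where "Y = (\<lambda>N \<omega>. MAX z\<in>assignments N (K N).
    \<bar>profile_loglik N (K N) (\<lambda>i j. of_bool (A N i j \<omega>)) z - profile_loglik N (K N) (P N) z\<bar>)"
  define R where "R = (\<lambda>N \<omega>. profile_loglik N (K N) (P N) (zbar N)
    - profile_loglik N (K N) (P N) (zhat N \<omega>))"
  have Y_small: "small_o_prob S Y M"
    using uniform by (simp add: Y_def M_def)
  have ev2: "\<forall>\<^sub>F N in sequentially. N \<ge> (2::nat)"
    by (rule eventually_ge_at_top)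
  have ev_prob: "\<forall>\<^sub>F N in sequentially. prob_space (S N)"
    using ev2 by eventually_elim (rule prob)
  have zhat: "zhat N \<omega> \<in> assignments N (K N)" if "N \<ge> 2" "\<omega> \<in> space (S N)" for N \<omega>
    using zhat_ML[OF that] by (simp add: is_arg_max_def)
  have ev_Y: "\<forall>\<^sub>F N in sequentially. Y N \<in> borel_measurable (S N)"
    using ev2
  proof eventually_elim
    case (elim N)
    interpret prob_space "S N"
      by (rule prob[OF elim])
    have A: "A N i j \<in> measurable (S N) (count_space UNIV)" if "(i, j) \<in> node_pairs N" for i j
      using A_indep[OF elim] that unfolding indep_vars_def by fastforce
    define G where "G = (\<lambda>E. MAX z\<in>assignments N (K N).
      \<bar>profile_loglik N (K N) (\<lambda>i j. of_bool ((i, j) \<in> E)) z - profile_loglik N (K N) (P N) z\<bar>)"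
    \<comment> \<open>The likelihood reads the weights on \<open>node_pairs N\<close> only.\<close>
    have "Y N = (\<lambda>\<omega>. G {(i, j)\<in>node_pairs N. A N i j \<omega>})"
    proof
      fix \<omega>
      have "profile_loglik N (K N) (\<lambda>i j. of_bool (A N i j \<omega>))
          = profile_loglik N (K N) (\<lambda>i j. of_bool ((i, j) \<in> {(i, j)\<in>node_pairs N. A N i j \<omega>}))"
        by (rule profile_loglik_cong) auto
      then show "Y N \<omega> = G {(i, j)\<in>node_pairs N. A N i j \<omega>}"
        by (simp only: Y_def G_def)
    qed
    with borel_measurable_of_edges[OF A, where G = G] show ?case
      by simp
  qed
  have R_le: "R N \<omega> \<le> 2 * Y N \<omega>" if "N \<ge> 2" "\<omega> \<in> space (S N)" for N \<omega>
    unfolding R_def Y_def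
    by (rule arg_max_perturbed[OF finite_assignments zhat_ML[OF that] zbar[OF that(1)]])
  have R_nonneg: "0 \<le> R N \<omega>" if N: "N \<ge> 2" and \<omega>: "\<omega> \<in> space (S N)" for N \<omega>
    unfolding R_def
  proof (rule profile_loglik_deficit_ge[OF zhat[OF N \<omega>] zbar[OF N] \<theta>bar[OF N] P[OF N]])
    fix \<theta>' assume \<theta>': "\<theta>' \<in> sym_prob_matrices (K N)"
      and ac: "\<And>i j. (i, j) \<in> node_pairs N \<Longrightarrow>
        bern_ac (\<theta>bar N (zbar N i) (zbar N j)) (\<theta>' (zhat N \<omega> i) (zhat N \<omega> j))"
    show "0 \<le> (\<Sum>(i, j)\<in>node_pairs N.
        bern_div (\<theta>bar N (zbar N i) (zbar N j)) (\<theta>' (zhat N \<omega> i) (zhat N \<omega> j)))"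
    proof (rule sum_nonneg, clarify)
      fix i j assume ij: "(i, j) \<in> node_pairs N"
      then have "i \<in> {1..N}" "j \<in> {1..N}"
        by (auto simp: node_pairs_def)
      note mem = this[THEN assignments_mem[OF zbar[OF N]]] this[THEN assignments_mem[OF zhat[OF N \<omega>]]]
      show "0 \<le> bern_div (\<theta>bar N (zbar N i) (zbar N j)) (\<theta>' (zhat N \<omega> i) (zhat N \<omega> j))"
        using mem \<theta>' \<theta>bar[OF N] by (intro bern_div_nonneg ac ij) (auto simp: sym_prob_matrices_def)
    qed
  qed
  have R_small: "small_o_prob S R M"
  proof (rule small_o_prob_dominated[OF Y_small ev_prob ev_Y])
    show "\<forall>\<^sub>F N in sequentially. \<forall>\<omega>\<in>space (S N). \<bar>R N \<omega> / M N\<bar> \<le> 2 * \<bar>Y N \<omega> / M N\<bar>"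
      using ev2
    proof (eventually_elim, intro ballI)
      fix N \<omega> assume N: "N \<ge> (2::nat)" and \<omega>: "\<omega> \<in> space (S N)"
      have "\<bar>R N \<omega>\<bar> \<le> 2 * \<bar>Y N \<omega>\<bar>"
        using R_le[OF N \<omega>] R_nonneg[OF N \<omega>] by linarith
      then show "\<bar>R N \<omega> / M N\<bar> \<le> 2 * \<bar>Y N \<omega> / M N\<bar>"
        by (simp add: abs_divide divide_right_mono)
    qed
  qed simp
  moreover have "small_o_prob S (\<lambda>N \<omega>. num_errors N (K N) (zbar N) (zhat N \<omega>)) real"
    if c1: "c1 > 0" and ev1: "\<forall>\<^sub>F N in sequentially.
        real (MIN a\<in>{1..K N}. class_size N (zbar N) a) \<ge> c1 * (real N / real (K N))"
      and c2: "c2 > 0" and ev_sep: "\<forall>\<^sub>F N in sequentially.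
        class_separation N (K N) (zbar N) (\<theta>bar N)
          \<ge> ereal (c2 * (expected_edges N (P N) * real (K N) / real N ^ 2))" for c1 c2
  proof (rule small_o_prob_dominated[OF Y_small ev_prob ev_Y])
    show "\<forall>\<^sub>F N in sequentially. \<forall>\<omega>\<in>space (S N).
      \<bar>num_errors N (K N) (zbar N) (zhat N \<omega>) / real N\<bar> \<le> 16 / (c1 * c2) * \<bar>Y N \<omega> / M N\<bar>"
      using ev2 ev1 ev_sep
    proof (eventually_elim, intro ballI)
      fix N \<omega> assume N: "N \<ge> (2::nat)"
        and size: "c1 * (real N / real (K N)) \<le> real (MIN a\<in>{1..K N}. class_size N (zbar N) a)"
        and sep: "ereal (c2 * (expected_edges N (P N) * real (K N) / real N ^ 2))
          \<le> class_separation N (K N) (zbar N) (\<theta>bar N)"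
        and \<omega>: "\<omega> \<in> space (S N)"
      define s where "s = c1 * (real N / real (K N))"
      define \<delta> where "\<delta> = c2 * (M N * real (K N) / real N ^ 2)"
      define e where "e = num_errors N (K N) (zbar N) (zhat N \<omega>)"
      have M: "M N > 0"
        using M_pos[OF N] by (simp add: M_def)
      have pos: "0 < real N" "0 < real (K N)"
        using N K[OF N] by auto
      have e: "0 \<le> e"
        unfolding e_def by (rule num_errors_nonneg[OF K[OF N]])
      have s_le: "s \<le> real (class_size N (zbar N) a)" if "a \<in> {1..K N}" for a
      proof -
        have "(MIN a\<in>{1..K N}. class_size N (zbar N) a) \<le> class_size N (zbar N) a"
          using that by (intro Min_le) auto
        with size show ?thesis
          unfolding s_def by linarith
      qed
      have "e * (\<delta> * s / 8) \<le> R N \<omega>"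
        unfolding R_def e_def
      proof (rule profile_loglik_deficit_ge[OF zhat[OF N \<omega>] zbar[OF N] \<theta>bar[OF N] P[OF N]])
        fix \<theta>' assume "\<theta>' \<in> sym_prob_matrices (K N)"
          and "\<And>i j. (i, j) \<in> node_pairs N \<Longrightarrow>
            bern_ac (\<theta>bar N (zbar N i) (zbar N j)) (\<theta>' (zhat N \<omega> i) (zhat N \<omega> j))"
        then show "num_errors N (K N) (zbar N) (zhat N \<omega>) * (\<delta> * s / 8)
          \<le> (\<Sum>(i, j)\<in>node_pairs N.
            bern_div (\<theta>bar N (zbar N i) (zbar N j)) (\<theta>' (zhat N \<omega> i) (zhat N \<omega> j)))"
          using sep s_le M c1 c2 pos
          by (intro num_errors_le_bern_div zhat zbar \<theta>bar N \<omega>) (auto simp: s_def \<delta>_def M_def)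
      qed
      also have "R N \<omega> \<le> 2 * \<bar>Y N \<omega>\<bar>"
        using R_le[OF N \<omega>] by linarith
      also have "\<delta> * s = c1 * c2 * M N / real N"
        using pos by (simp add: \<delta>_def s_def power2_eq_square)
      finally have "e / real N * (c1 * c2 * M N) \<le> 16 * \<bar>Y N \<omega>\<bar>"
        using pos by (simp add: pos_divide_le_eq)
      then have "e / real N \<le> 16 * \<bar>Y N \<omega>\<bar> / (c1 * c2 * M N)"
        using M c1 c2 by (subst pos_le_divide_eq) auto
      also have "\<dots> = 16 / (c1 * c2) * \<bar>Y N \<omega> / M N\<bar>"
        using M by (simp add: abs_divide)
      finally show "\<bar>num_errors N (K N) (zbar N) (zhat N \<omega>) / real N\<bar>
          \<le> 16 / (c1 * c2) * \<bar>Y N \<omega> / M N\<bar>"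
        using e by (simp add: abs_divide flip: e_def)
    qed
    show "0 < 16 / (c1 * c2)"
      using c1 c2 by simp
  qed
  ultimately show ?thesis
    unfolding R_def M_def by blast
qed

end
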